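(* Let $a>b>0$, $c=\sqrt{a^2-b^2}$, and let $\mathcal{E}$ be the ellipse $(x/a)^2+(y/b)^2=1$. Over the focal-$X_4$ family, i.e., the Poncelet family of triangles inscribed in $\mathcal{E}$ whose common incircle has center $\left[\pm\frac{a^2c}{2a^2-c^2},0\right]$ (either fixed choice of sign) and radius $\frac{a(a^2-c^2)}{2a^2-c^2}$, the (negative) squared radius of the polar circle is conserved, at $$r_{pol}^2=-\frac{b^4}{a^2+b^2}.$$
   Context: Points of the plane are written $[x,y]$. The Poncelet family of triangles inscribed in $\mathcal{E}$ with a given circle as incircle (caustic) is the set of all triangles with vertices on $\mathcal{E}$ whose three sides are tangent to the circle; for the circle given, every point of $\mathcal{E}$ is a vertex of such a triangle. The polar circle of a triangle with circumradius $R$ and sidelengths $l_1,l_2,l_3$ is centered on the orthocenter and has squared radius $r_{pol}^2=4R^2-\frac12\sum_{i=1}^3 l_i^2$ (positive for obtuse triangles, negative for acute triangles). A quantity is conserved if it has the same value for all triangles in the family. *)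

theory Defs
  imports "HOL-Analysis.Analysis"
begin

definition ellipse :: "real \<Rightarrow> real \<Rightarrow> (real^2) set" where
  "ellipse a b = {P. (P $ 1 / a)\<^sup>2 + (P $ 2 / b)\<^sup>2 = 1}"

text \<open>
  A line is tangent to a circle of positive radius iff it meets it in exactly one point.
\<close>

definition line_tangent_circle :: "real^2 \<Rightarrow> real^2 \<Rightarrow> real^2 \<Rightarrow> real \<Rightarrow> bool" where
  "line_tangent_circle P Q Z r \<longleftrightarrow> (\<exists>T. affine hull {P, Q} \<inter> sphere Z r = {T})"

text \<open>
  Triangles are ordered triples of non-collinear points. Tangency of a side refers to the
  line carrying it. For a circle lying inside \<^term>\<open>ellipse a b\<close>, a tangent line touches the
  circle at a point strictly between its two intersections with the ellipse, so the circle
  is then the incircle of each triangle of the family, never an excircle.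
\<close>

definition poncelet_family ::
    "real \<Rightarrow> real \<Rightarrow> real^2 \<Rightarrow> real \<Rightarrow> ((real^2) \<times> (real^2) \<times> (real^2)) set" where
  "poncelet_family a b Z r =
     {(A, B, C). \<not> collinear {A, B, C} \<and>
        A \<in> ellipse a b \<and> B \<in> ellipse a b \<and> C \<in> ellipse a b \<and>
        line_tangent_circle A B Z r \<and>
        line_tangent_circle B C Z r \<and>
        line_tangent_circle C A Z r}"

definition circumradius :: "real^2 \<Rightarrow> real^2 \<Rightarrow> real^2 \<Rightarrow> real" where
  "circumradius A B C = (THE R. \<exists>M. dist M A = R \<and> dist M B = R \<and> dist M C = R)"

text \<open>
  The squared radius of the polar circle; it is a signed quantity, negative for acute triangles.
\<close>

definition polar_sqradius :: "real^2 \<Rightarrow> real^2 \<Rightarrow> real^2 \<Rightarrow> real" where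
  "polar_sqradius A B C =
     4 * (circumradius A B C)\<^sup>2 - ((dist A B)\<^sup>2 + (dist B C)\<^sup>2 + (dist C A)\<^sup>2) / 2"

end

theory Submission
  imports Defs
begin

text \<open>
  Write \<open>F = [s c, 0]\<close> for the focus on the side of the circle's centre \<open>Z\<close> and
  \<open>k = - b\<^sup>4 / (a\<^sup>2 + b\<^sup>2)\<close>. The theorem is a statement about single chords in disguise:
  whenever a chord \<open>P Q\<close> of the ellipse touches the circle, \<open>(P - F) \<bullet> (Q - F) = k\<close>
  (\<open>tangent_chord_focal_product\<close>).

  For a triangle of the family this holds for all three sides. Subtracting two of the equations
  gives \<open>(A - F) \<bullet> (B - C) = 0\<close> and its analogues, so \<open>F\<close> is the orthocentre of every triangle.
  The common value of the three products of vectors from the orthocentre to the vertices is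
  the squared radius of the polar circle (\<open>polar_sqradius_orthocentre\<close>): taking \<open>F\<close> as origin,
  the circumcentre is \<open>(A + B + C) / 2\<close>, and both \<open>R\<^sup>2\<close> and the sum of the squared sides are linear in
  \<open>|A|\<^sup>2 + |B|\<^sup>2 + |C|\<^sup>2\<close> and \<open>k\<close>, with the sum of squares cancelling.

  The chord property is an instance of Vieta's formulas. For a line with unit normal
  \<open>(cos \<theta>, sin \<theta>)\<close> at signed distance \<open>p\<close> from the origin, the product over its two points on
  the ellipse is a rational function of \<open>p\<close> and \<open>\<theta>\<close>, and setting it equal to a constant \<open>k\<close>
  gives \<open>(a\<^sup>2 + b\<^sup>2) p\<^sup>2 - 2 c a\<^sup>2 p cos \<theta> + (c\<^sup>2 - k) (b\<^sup>2 + c\<^sup>2 cos\<^sup>2 \<theta>) - a\<^sup>2 b\<^sup>2 = 0\<close> (for \<open>s = 1\<close>).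
  The tangents of a circle centred at \<open>[z, 0]\<close> with radius \<open>r\<close> are the lines
  \<open>(p - z cos \<theta>)\<^sup>2 = r\<^sup>2\<close>. Comparing coefficients gives \<open>z = a\<^sup>2 c / (a\<^sup>2 + b\<^sup>2)\<close>,
  \<open>r = a b\<^sup>2 / (a\<^sup>2 + b\<^sup>2)\<close> and \<open>k = c\<^sup>2 - a\<^sup>4 / (a\<^sup>2 + b\<^sup>2) = - b\<^sup>4 / (a\<^sup>2 + b\<^sup>2)\<close>, which are the
  centre, the radius and the constant of the theorem.
\<close>

text \<open>
  The reflection in the perpendicular from \<open>Z\<close> preserves both the line and the sphere, so a
  unique common point must be the foot of that perpendicular.
\<close>

lemma tangent_point_orthogonal:
  fixes P Q Z :: "real^2"
  assumes "line_tangent_circle P Q Z r" and "P \<noteq> Q"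
  obtains u where "(P + u *\<^sub>R (Q - P) - Z) \<bullet> (Q - P) = 0" and "dist Z (P + u *\<^sub>R (Q - P)) = r"
proof -
  from assms(1) obtain T where T: "affine hull {P, Q} \<inter> sphere Z r = {T}"
    unfolding line_tangent_circle_def by blast
  then have "T \<in> affine hull {P, Q}" and distT: "dist Z T = r" by (auto simp: set_eq_iff)
  then obtain u where u: "T = P + u *\<^sub>R (Q - P)" by (auto simp: affine_hull_2_alt)
  define n where "n = (Q - P) \<bullet> (Q - P)"
  have "n \<noteq> 0" using assms(2) by (simp add: n_def)
  define h where "h = (T - Z) \<bullet> (Q - P) / n"
  define T' where "T' = T - (2 * h) *\<^sub>R (Q - P)"
  have "T' = P + (u - 2 * h) *\<^sub>R (Q - P)"
    by (simp add: T'_def u algebra_simps)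
  then have on_line: "T' \<in> affine hull {P, Q}" by (auto simp: affine_hull_2_alt)
  have "(T' - Z) \<bullet> (T' - Z)
      = (T - Z) \<bullet> (T - Z) - 4 * h * ((T - Z) \<bullet> (Q - P)) + 4 * h * (h * n)"
    unfolding T'_def n_def by (simp add: inner_simps inner_commute algebra_simps)
  also have "h * n = (T - Z) \<bullet> (Q - P)" using \<open>n \<noteq> 0\<close> by (simp add: h_def)
  finally have "norm (T' - Z) = norm (T - Z)" by (simp add: norm_eq_sqrt_inner)
  then have "dist Z T' = r" using distT by (simp add: dist_norm norm_minus_commute)
  with on_line T have "T' = T" by (auto simp: set_eq_iff)
  then have "(T - Z) \<bullet> (Q - P) = 0" using assms(2) \<open>n \<noteq> 0\<close> by (simp add: T'_def h_def)
  with distT u that show thesis by blast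
qed

text \<open>
  The distance from the centre to a tangent line is the radius; the determinant is twice the
  area of the triangle \<open>P Q Z\<close>, whose height over \<open>P Q\<close> is that distance.
\<close>

lemma tangent_line_det:
  fixes P Q Z :: "real^2"
  assumes "line_tangent_circle P Q Z r" and "P \<noteq> Q"
  shows "((P$1 - Z$1) * (Q$2 - P$2) - (P$2 - Z$2) * (Q$1 - P$1))\<^sup>2
         = r\<^sup>2 * ((Q$1 - P$1)\<^sup>2 + (Q$2 - P$2)\<^sup>2)"
proof -
  obtain u where orth: "(P + u *\<^sub>R (Q - P) - Z) \<bullet> (Q - P) = 0"
      and rad: "dist Z (P + u *\<^sub>R (Q - P)) = r"
    using tangent_point_orthogonal[OF assms] .
  define x y p q where "x = Q$1 - P$1" "y = Q$2 - P$2"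
    "p = P$1 + u * x - Z$1" "q = P$2 + u * y - Z$2"
  note defs = this
  have o: "p * x + q * y = 0"
    using orth by (simp add: inner_vec_def sum_2 defs)
  have "r\<^sup>2 = (P + u *\<^sub>R (Q - P) - Z) \<bullet> (P + u *\<^sub>R (Q - P) - Z)"
    using rad by (metis dist_commute dist_norm power2_norm_eq_inner)
  then have r: "r\<^sup>2 = p\<^sup>2 + q\<^sup>2"
    by (simp add: inner_vec_def sum_2 defs power2_eq_square)
  have "((P$1 - Z$1) * y - (P$2 - Z$2) * x)\<^sup>2 = (p * y - q * x)\<^sup>2"
    by (simp add: defs(3,4) algebra_simps)
  also have "\<dots> = (p\<^sup>2 + q\<^sup>2) * (x\<^sup>2 + y\<^sup>2) - (p * x + q * y)\<^sup>2"
    by (simp add: power2_eq_square algebra_simps)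
  finally show ?thesis unfolding o r by (simp add: defs(1,2))
qed

text \<open>
  The chord property in coordinates, for a chord with midpoint \<open>[x, y]\<close> and half-difference
  \<open>[d, e]\<close>. The midpoint lies on the diameter conjugate to the direction of the chord, which
  makes it a multiple of \<open>[a\<^sup>2 e, - b\<^sup>2 d]\<close>.
\<close>

lemma tangent_chord_focal_product_coords:
  fixes a b c x y d e :: real
  assumes "a > 0" "b > 0" and c: "c\<^sup>2 = a\<^sup>2 - b\<^sup>2" and "d \<noteq> 0 \<or> e \<noteq> 0"
    and conj: "b\<^sup>2 * x * d + a\<^sup>2 * y * e = 0"
    and ell: "b\<^sup>2 * (x\<^sup>2 + d\<^sup>2) + a\<^sup>2 * (y\<^sup>2 + e\<^sup>2) = a\<^sup>2 * b\<^sup>2"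
    and tang: "((x - a\<^sup>2 * c / (a\<^sup>2 + b\<^sup>2)) * e - y * d)\<^sup>2 = (a * b\<^sup>2 / (a\<^sup>2 + b\<^sup>2))\<^sup>2 * (d\<^sup>2 + e\<^sup>2)"
  shows "(x - c)\<^sup>2 + y\<^sup>2 - d\<^sup>2 - e\<^sup>2 = - (b ^ 4 / (a\<^sup>2 + b\<^sup>2))"
proof -
  define S where "S = a\<^sup>2 + b\<^sup>2"
  define D where "D = a\<^sup>2 * e\<^sup>2 + b\<^sup>2 * d\<^sup>2"
  define l where "l = (x * e - y * d) / D"
  have "S > 0" using assms(1,2) by (simp add: S_def add_pos_pos)
  have "D > 0" using assms(1,2,4) unfolding D_def
    by (auto intro: add_pos_nonneg add_nonneg_pos)
  have lD: "l * D = x * e - y * d" using \<open>D > 0\<close> by (simp add: l_def)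
  have "x * D = a\<^sup>2 * e * (x * e - y * d) + d * (b\<^sup>2 * x * d + a\<^sup>2 * y * e)"
    by (simp add: D_def power2_eq_square algebra_simps)
  then have "x * D = l * a\<^sup>2 * e * D" unfolding conj lD[symmetric] by (simp add: ac_simps)
  then have x: "x = l * a\<^sup>2 * e" using \<open>D > 0\<close> by simp
  have "y * D = - b\<^sup>2 * d * (x * e - y * d) + e * (b\<^sup>2 * x * d + a\<^sup>2 * y * e)"
    by (simp add: D_def power2_eq_square algebra_simps)
  then have "y * D = (- l * b\<^sup>2 * d) * D" unfolding conj lD[symmetric] by (simp add: ac_simps)
  then have y: "y = - l * b\<^sup>2 * d" using \<open>D > 0\<close> mult_right_cancel[of D] by blast
  have rel: "D * (1 + l\<^sup>2 * a\<^sup>2 * b\<^sup>2) = a\<^sup>2 * b\<^sup>2"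
    using ell unfolding x y D_def by (simp add: power2_eq_square algebra_simps)
  have "((x - a\<^sup>2 * c / S) * e - y * d) * S = S * l * D - a\<^sup>2 * c * e"
    using \<open>S > 0\<close> unfolding x y D_def by (simp add: field_simps power2_eq_square)
  then have "(S * l * D - a\<^sup>2 * c * e)\<^sup>2 = (((x - a\<^sup>2 * c / S) * e - y * d) * S)\<^sup>2" by simp
  also have "\<dots> = (a * b\<^sup>2)\<^sup>2 * (d\<^sup>2 + e\<^sup>2)"
    using tang \<open>S > 0\<close> by (simp add: power_mult_distrib power_divide flip: S_def)
  finally have tang': "(S * l * D - a\<^sup>2 * c * e)\<^sup>2 = a\<^sup>2 * b ^ 4 * (d\<^sup>2 + e\<^sup>2)"
    by (simp add: power_mult_distrib)
  have norms: "a ^ 4 * e\<^sup>2 + b ^ 4 * d\<^sup>2 = S * D - a\<^sup>2 * b\<^sup>2 * (d\<^sup>2 + e\<^sup>2)"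
    by (simp add: S_def D_def power2_eq_square power4_eq_xxxx algebra_simps)
  have "(x - c)\<^sup>2 + y\<^sup>2 - d\<^sup>2 - e\<^sup>2
      = l\<^sup>2 * (a ^ 4 * e\<^sup>2 + b ^ 4 * d\<^sup>2) - 2 * c * a\<^sup>2 * l * e + c\<^sup>2 - (d\<^sup>2 + e\<^sup>2)"
    unfolding x y by (simp add: power2_eq_square power4_eq_xxxx algebra_simps)
  also have "\<dots> = S * l\<^sup>2 * D - 2 * c * a\<^sup>2 * l * e + c\<^sup>2 - (1 + l\<^sup>2 * a\<^sup>2 * b\<^sup>2) * (d\<^sup>2 + e\<^sup>2)"
    unfolding norms by (simp add: algebra_simps)
  finally have prod: "(x - c)\<^sup>2 + y\<^sup>2 - d\<^sup>2 - e\<^sup>2 = \<dots>" .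
  \<comment> \<open>Multiplying by \<open>D\<close> turns the factor \<open>1 + l\<^sup>2 a\<^sup>2 b\<^sup>2\<close> into the constant \<open>a\<^sup>2 b\<^sup>2\<close>, and multiplying
      by \<open>S\<close> completes the square that occurs in the tangency condition.\<close>
  have "S * D * ((x - c)\<^sup>2 + y\<^sup>2 - d\<^sup>2 - e\<^sup>2)
      = (S * l * D - a\<^sup>2 * c * e)\<^sup>2 - a ^ 4 * c\<^sup>2 * e\<^sup>2 + S * D * c\<^sup>2
        - S * (D * (1 + l\<^sup>2 * a\<^sup>2 * b\<^sup>2)) * (d\<^sup>2 + e\<^sup>2)"
    unfolding prod by (simp add: power2_eq_square power4_eq_xxxx algebra_simps)
  also have "\<dots> = - (b ^ 4) * D"
    unfolding tang' rel unfolding c S_def D_def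
    by (simp add: power2_eq_square power4_eq_xxxx algebra_simps)
  finally have "D * (S * ((x - c)\<^sup>2 + y\<^sup>2 - d\<^sup>2 - e\<^sup>2)) = D * (- (b ^ 4))"
    by (simp only: ac_simps)
  then have "S * ((x - c)\<^sup>2 + y\<^sup>2 - d\<^sup>2 - e\<^sup>2) = - (b ^ 4)"
    using \<open>D > 0\<close> mult_left_cancel[of D] by blast
  then have "(x - c)\<^sup>2 + y\<^sup>2 - d\<^sup>2 - e\<^sup>2 = - (b ^ 4) / S"
    using \<open>S > 0\<close> by (metis nonzero_mult_div_cancel_left less_irrefl)
  then show ?thesis by (simp add: S_def)
qed

lemma ellipse_iff:
  assumes "a \<noteq> 0" "b \<noteq> 0"
  shows "P \<in> ellipse a b \<longleftrightarrow> b\<^sup>2 * (P$1)\<^sup>2 + a\<^sup>2 * (P$2)\<^sup>2 = a\<^sup>2 * b\<^sup>2"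
  using assms by (auto simp: ellipse_def field_simps)

text \<open>
  Here \<open>c\<close> may have either sign, so that both choices of focus are covered.
\<close>

lemma tangent_chord_focal_product:
  fixes a b c :: real and P Q :: "real^2"
  assumes ab: "a > 0" "b > 0" and c: "c\<^sup>2 = a\<^sup>2 - b\<^sup>2"
    and PQ: "P \<in> ellipse a b" "Q \<in> ellipse a b" "P \<noteq> Q"
    and tang: "line_tangent_circle P Q (vector [a\<^sup>2 * c / (a\<^sup>2 + b\<^sup>2), 0]) (a * b\<^sup>2 / (a\<^sup>2 + b\<^sup>2))"
  shows "(P - vector [c, 0]) \<bullet> (Q - vector [c, 0]) = - (b ^ 4 / (a\<^sup>2 + b\<^sup>2))"
proof -
  define x y d e where "x = (P$1 + Q$1) / 2" "y = (P$2 + Q$2) / 2"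
    "d = (P$1 - Q$1) / 2" "e = (P$2 - Q$2) / 2"
  note defs = this
  have P: "P$1 = x + d" "P$2 = y + e" and Q: "Q$1 = x - d" "Q$2 = y - e"
    by (simp_all add: defs field_simps)
  have de: "d \<noteq> 0 \<or> e \<noteq> 0"
    using PQ(3) P Q by (auto simp: vec_eq_iff forall_2)
  have 1: "b\<^sup>2 * (x + d)\<^sup>2 + a\<^sup>2 * (y + e)\<^sup>2 = a\<^sup>2 * b\<^sup>2"
    using PQ(1) ab by (simp add: ellipse_iff P)
  have 2: "b\<^sup>2 * (x - d)\<^sup>2 + a\<^sup>2 * (y - e)\<^sup>2 = a\<^sup>2 * b\<^sup>2"
    using PQ(2) ab by (simp add: ellipse_iff Q)
  have conj: "b\<^sup>2 * x * d + a\<^sup>2 * y * e = 0"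
    using 1 2 by (simp add: power2_eq_square algebra_simps)
  have ell: "b\<^sup>2 * (x\<^sup>2 + d\<^sup>2) + a\<^sup>2 * (y\<^sup>2 + e\<^sup>2) = a\<^sup>2 * b\<^sup>2"
    using 1 2 by (simp add: power2_eq_square algebra_simps)
  let ?z = "a\<^sup>2 * c / (a\<^sup>2 + b\<^sup>2)" and ?r = "a * b\<^sup>2 / (a\<^sup>2 + b\<^sup>2)"
  have "((x + d - ?z) * (- 2 * e) - (y + e) * (- 2 * d))\<^sup>2 = ?r\<^sup>2 * ((- 2 * d)\<^sup>2 + (- 2 * e)\<^sup>2)"
    using tangent_line_det[OF tang PQ(3)] by (simp add: P Q)
  then have "4 * ((x - ?z) * e - y * d)\<^sup>2 = 4 * (?r\<^sup>2 * (d\<^sup>2 + e\<^sup>2))"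
    by algebra
  then have "((x - ?z) * e - y * d)\<^sup>2 = ?r\<^sup>2 * (d\<^sup>2 + e\<^sup>2)"
    by linarith
  from tangent_chord_focal_product_coords[OF ab c de conj ell this]
  have "(x - c)\<^sup>2 + y\<^sup>2 - d\<^sup>2 - e\<^sup>2 = - (b ^ 4 / (a\<^sup>2 + b\<^sup>2))" .
  moreover have "(P - vector [c, 0]) \<bullet> (Q - vector [c, 0]) = (x - c)\<^sup>2 + y\<^sup>2 - d\<^sup>2 - e\<^sup>2"
    by (simp add: inner_vec_def sum_2 P Q power2_eq_square algebra_simps)
  ultimately show ?thesis by simp
qed

lemma collinear_if_differences_orthogonal:
  fixes w :: "real^2"
  assumes "w \<noteq> 0" and orth: "\<And>x y. x \<in> S \<Longrightarrow> y \<in> S \<Longrightarrow> (x - y) \<bullet> w = 0"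
  shows "collinear S"
proof -
  define u :: "real^2" where "u = vector [- w$2, w$1]"
  have n: "(w$1)\<^sup>2 + (w$2)\<^sup>2 \<noteq> 0"
    using assms(1) by (simp add: vec_eq_iff forall_2 sum_power2_eq_zero_iff)
  have "v = ((v \<bullet> u) / ((w$1)\<^sup>2 + (w$2)\<^sup>2)) *\<^sub>R u" if "v \<bullet> w = 0" for v
  proof -
    have "v$1 * w$1 + v$2 * w$2 = 0" using that by (simp add: inner_vec_def sum_2)
    then have "v$1 * ((w$1)\<^sup>2 + (w$2)\<^sup>2) = (v$2 * w$1 - v$1 * w$2) * (- w$2)"
      and "v$2 * ((w$1)\<^sup>2 + (w$2)\<^sup>2) = (v$2 * w$1 - v$1 * w$2) * w$1"
      by algebra+
    then show ?thesis
      using n by (simp add: vec_eq_iff forall_2 inner_vec_def sum_2 u_def field_simps)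
  qed
  then show ?thesis unfolding collinear_def using orth by blast
qed

text \<open>
  The difference of two circumcentres would be orthogonal to all three sides.
\<close>

lemma circumradius_eqI:
  fixes A B C M :: "real^2"
  assumes nc: "\<not> collinear {A, B, C}"
    and M: "dist M A = R" "dist M B = R" "dist M C = R"
  shows "circumradius A B C = R"
  unfolding circumradius_def
proof (rule the_equality)
  show "\<exists>M. dist M A = R \<and> dist M B = R \<and> dist M C = R" using M by blast
next
  fix R' assume "\<exists>M'. dist M' A = R' \<and> dist M' B = R' \<and> dist M' C = R'"
  then obtain M' where M': "dist M' A = R'" "dist M' B = R'" "dist M' C = R'" by blast
  have orth: "(X - Y) \<bullet> (M - M') = 0"
    if "dist M X = R" "dist M Y = R" "dist M' X = R'" "dist M' Y = R'" for X Y
  proof -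
    have "(M - X) \<bullet> (M - X) = (M - Y) \<bullet> (M - Y)" "(M' - X) \<bullet> (M' - X) = (M' - Y) \<bullet> (M' - Y)"
      using that by (auto simp: dist_norm norm_eq_sqrt_inner)
    then show ?thesis by (simp add: inner_simps inner_commute algebra_simps)
  qed
  have "M - M' = 0"
  proof (rule ccontr)
    assume "M - M' \<noteq> 0"
    then have "collinear {A, B, C}"
      by (rule collinear_if_differences_orthogonal) (use orth M M' in auto)
    with nc show False ..
  qed
  then show "R' = R" using M M' by simp
qed

text \<open>
  Equality of the three products says that \<open>H\<close> is the orthocentre. By Euler's relation the
  circumcentre, seen from \<open>H\<close>, is half the sum of the vertices.
\<close>

lemma polar_sqradius_orthocentre:
  fixes A B C H :: "real^2"
  assumes nc: "\<not> collinear {A, B, C}"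
    and AB: "(A - H) \<bullet> (B - H) = k" and BC: "(B - H) \<bullet> (C - H) = k" and CA: "(C - H) \<bullet> (A - H) = k"
  shows "polar_sqradius A B C = k"
proof -
  define u v w where "u = A - H" "v = B - H" "w = C - H"
  note defs = this
  have k: "u \<bullet> v = k" "v \<bullet> u = k" "v \<bullet> w = k" "w \<bullet> v = k" "w \<bullet> u = k" "u \<bullet> w = k"
    using AB BC CA by (simp_all add: defs inner_commute)
  define q where "q = u \<bullet> u + v \<bullet> v + w \<bullet> w"
  define M where "M = H + (1/2) *\<^sub>R (u + v + w)"
  have centre: "M - A = (1/2) *\<^sub>R (v + w - u)" "M - B = (1/2) *\<^sub>R (w + u - v)"
      "M - C = (1/2) *\<^sub>R (u + v - w)"
    by (simp_all add: M_def defs vec_eq_iff field_simps)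
  \<comment> \<open>The value is symmetric in the vertices, so \<open>M\<close> is equidistant from them.\<close>
  have "(M - A) \<bullet> (M - A) = (q - 2 * k) / 4" "(M - B) \<bullet> (M - B) = (q - 2 * k) / 4"
      "(M - C) \<bullet> (M - C) = (q - 2 * k) / 4"
    unfolding centre q_def by (simp_all add: inner_simps k field_simps)
  moreover from this(1) have nonneg: "0 \<le> (q - 2 * k) / 4"
    by (metis inner_ge_zero)
  ultimately have dists: "dist M A = sqrt ((q - 2 * k) / 4)" "dist M B = sqrt ((q - 2 * k) / 4)"
      "dist M C = sqrt ((q - 2 * k) / 4)"
    by (simp_all only: dist_norm norm_eq_sqrt_inner)
  have R: "(circumradius A B C)\<^sup>2 = (q - 2 * k) / 4"
    unfolding circumradius_eqI[OF nc dists] using nonneg by simp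
  have "A - B = u - v" "B - C = v - w" "C - A = w - u" by (simp_all add: defs)
  then have "(dist A B)\<^sup>2 + (dist B C)\<^sup>2 + (dist C A)\<^sup>2 = 2 * q - 6 * k"
    by (simp add: dist_norm power2_norm_eq_inner inner_simps k q_def)
  with R show ?thesis by (simp add: polar_sqradius_def field_simps)
qed

theorem proposition6:
  fixes a b c s :: real
  assumes "a > b" and "b > 0"
    and "c = sqrt (a\<^sup>2 - b\<^sup>2)"
    and "s = 1 \<or> s = -1"
  shows "(\<forall>(A, B, C) \<in> poncelet_family a b
            (vector [s * (a\<^sup>2 * c / (2 * a\<^sup>2 - c\<^sup>2)), 0])
            (a * (a\<^sup>2 - c\<^sup>2) / (2 * a\<^sup>2 - c\<^sup>2)).
            polar_sqradius A B C = - (b ^ 4 / (a\<^sup>2 + b\<^sup>2)))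
         \<and> - (b ^ 4 / (a\<^sup>2 + b\<^sup>2)) < 0"
proof -
  have a: "a > 0" using assms(1,2) by simp
  have "b\<^sup>2 \<le> a\<^sup>2" using assms(1,2) by (simp add: power_mono)
  then have c2: "c\<^sup>2 = a\<^sup>2 - b\<^sup>2" by (simp add: assms(3))
  have sc: "(s * c)\<^sup>2 = a\<^sup>2 - b\<^sup>2" using assms(4) c2 by (auto simp: power_mult_distrib)
  have Z: "s * (a\<^sup>2 * c / (2 * a\<^sup>2 - c\<^sup>2)) = a\<^sup>2 * (s * c) / (a\<^sup>2 + b\<^sup>2)"
    by (simp add: c2)
  have r: "a * (a\<^sup>2 - c\<^sup>2) / (2 * a\<^sup>2 - c\<^sup>2) = a * b\<^sup>2 / (a\<^sup>2 + b\<^sup>2)"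
    by (simp add: c2)
  let ?F = "vector [s * c, 0] :: real^2"
  have "polar_sqradius A B C = - (b ^ 4 / (a\<^sup>2 + b\<^sup>2))"
    if "(A, B, C) \<in> poncelet_family a b (vector [a\<^sup>2 * (s * c) / (a\<^sup>2 + b\<^sup>2), 0])
          (a * b\<^sup>2 / (a\<^sup>2 + b\<^sup>2))" for A B C
  proof (rule polar_sqradius_orthocentre[where H = ?F])
    show nc: "\<not> collinear {A, B, C}" using that by (simp add: poncelet_family_def)
    then have "A \<noteq> B" "B \<noteq> C" "C \<noteq> A" by (auto simp: insert_commute)
    with that show "(A - ?F) \<bullet> (B - ?F) = - (b ^ 4 / (a\<^sup>2 + b\<^sup>2))"
      "(B - ?F) \<bullet> (C - ?F) = - (b ^ 4 / (a\<^sup>2 + b\<^sup>2))"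
      "(C - ?F) \<bullet> (A - ?F) = - (b ^ 4 / (a\<^sup>2 + b\<^sup>2))"
      by (auto simp: poncelet_family_def intro!: tangent_chord_focal_product[OF a assms(2) sc])
  qed
  moreover have "- (b ^ 4 / (a\<^sup>2 + b\<^sup>2)) < 0"
    using a assms(2) by (simp add: add_pos_pos)
  ultimately show ?thesis unfolding Z r by blast
qed

end
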